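(* For any real numbers $a<b$, there exists a $C^{\infty}$ function $F:\mathbb{R}^3\to\mathbb{R}$ such that the set of solutions $y:[a,b]\to\mathbb{R}$ of the third order ordinary differential equation $$y'''=F(y,y',y'')$$ on $[a,b]$ is dense in $C^0([a,b])$ for the uniform norm.
   Context: $C^0([a,b])$ denotes the space of continuous real-valued functions on the segment $[a,b]$, equipped with the uniform (sup) norm. A solution on $[a,b]$ is a three times differentiable function $y:[a,b]\to\mathbb{R}$ satisfying $y'''(t)=F(y(t),y'(t),y''(t))$ for all $t\in[a,b]$ (one-sided derivatives at the endpoints). *)

theory Defs
  imports "HOL-Analysis.Analysis"
begin

text \<open>
  Joint continuity of all iterated directional derivatives of order at most \<open>k\<close>; the domain is
  Euclidean because in infinite dimension this would be weaker than continuity of the Frechet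
  derivatives in operator norm.
\<close>

primrec Ck :: "nat \<Rightarrow> ('a::euclidean_space \<Rightarrow> 'b::real_normed_vector) \<Rightarrow> bool" where
  "Ck 0 f \<longleftrightarrow> continuous_on UNIV f"
| "Ck (Suc k) f \<longleftrightarrow>
     (\<forall>x. f differentiable (at x)) \<and> (\<forall>v. Ck k (\<lambda>x. frechet_derivative f (at x) v))"

definition C_infinity :: "('a::euclidean_space \<Rightarrow> 'b::real_normed_vector) \<Rightarrow> bool" where
  "C_infinity f \<longleftrightarrow> (\<forall>k. Ck k f)"

definition is_solution :: "real \<Rightarrow> real \<Rightarrow> (real^3 \<Rightarrow> real) \<Rightarrow> (real \<Rightarrow> real) \<Rightarrow> bool" where
  "is_solution a b F y \<longleftrightarrow>
     (\<exists>y' y''. \<forall>t\<in>{a..b}.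
        (y has_real_derivative y' t) (at t within {a..b}) \<and>
        (y' has_real_derivative y'' t) (at t within {a..b}) \<and>
        (y'' has_real_derivative F (vector [y t, y' t, y'' t])) (at t within {a..b}))"

text \<open>
  A real function on \<open>[a,b]\<close> is represented by its extension with value \<open>undefined\<close> outside,
  as in the library's \<open>cfunspace\<close>.
\<close>

definition solutions :: "real \<Rightarrow> real \<Rightarrow> (real^3 \<Rightarrow> real) \<Rightarrow> (real \<Rightarrow> real) set" where
  "solutions a b F = {y \<in> extensional {a..b}. is_solution a b F y}"

text \<open>
  The metric of \<open>cfunspace\<close> is the supremum distance. Its elements are the bounded continuous
  functions; on the compact segment boundedness is automatic.
\<close>

definition C0 :: "real \<Rightarrow> real \<Rightarrow> (real \<Rightarrow> real) metric" where
  "C0 a b = cfunspace (top_of_set {a..b}) euclidean_metric"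

lemma mspace_C0: "mspace (C0 a b) = {f \<in> extensional {a..b}. continuous_on {a..b} f}"
proof -
  have "bounded (f ` {a..b})" if "continuous_on {a..b} f" for f :: "real \<Rightarrow> real"
    using that compact_continuous_image compact_imp_bounded by blast
  then show ?thesis
    unfolding C0_def mspace_cfunspace
    by (auto simp: Metric_space.mbounded_def)
qed

lemma C0_mdist_le:
  assumes "f \<in> mspace (C0 a b)" "g \<in> mspace (C0 a b)" "a \<le> b"
  shows "mdist (C0 a b) f g \<le> e \<longleftrightarrow> (\<forall>t\<in>{a..b}. \<bar>f t - g t\<bar> \<le> e)"
  using cfunspace_mdist_le[OF assms(1,2)[unfolded C0_def]] assms(3)
  by (simp add: C0_def dist_real_def)

lemma solutions_subset_C0: "solutions a b F \<subseteq> mspace (C0 a b)"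
  unfolding mspace_C0 solutions_def is_solution_def
  by (auto intro!: DERIV_continuous_on)

end

theory Submission
  imports Defs
begin

text \<open>
  The idea is to build \<open>F\<close> in countably many stages, one for each pair of a function \<open>p\<close> from a
  countable dense set of polynomials and a tolerance, and to give each stage its own region of the
  phase space, further and further away from the origin.

  What makes this possible is that uniform closeness to \<open>p\<close> says nothing about derivatives. Adding a
  fast oscillation of small amplitude to \<open>p\<close> gives a function \<open>y\<close> close to \<open>p\<close> whose jet
  \<open>(y, y', y'')\<close> stays outside any prescribed ball (\<open>oscillating_approximation\<close>). A third-order
  autonomous equation has three-dimensional phase space, which is enough room for the curve to avoid
  itself: by a dimension count, a small cubic correction makes the jet injective
  (\<open>injective_jet_perturbation\<close>). It is also immersed, because \<open>y'\<close> and \<open>y''\<close> do not vanish together.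
  Hence \<open>y'''\<close> is a smooth function of the jet on an embedded compact arc. Such a function extends
  smoothly to the whole space without changing a given smooth function on a closed set disjoint from
  the arc (\<open>smooth_extension\<close>).

  Therefore a smooth right-hand side can be modified outside a given ball so that \<open>y\<close> becomes a
  solution (\<open>prescribe_approximate_solution\<close>). The next stage modifies it only outside a
  larger ball containing the arc, so \<open>y\<close> remains a solution. The radii tend to infinity, hence the
  right-hand sides are eventually constant on every ball, and their limit \<open>F\<close> is smooth
  (\<open>glue_exhaustion\<close>) and has all the functions \<open>y\<close> among its solutions.
\<close>

section \<open>Calculus of smooth functions\<close>

lemma Ck_SucI:
  assumes "\<And>x. (f has_derivative D x) (at x)" and "\<And>v. Ck k (\<lambda>x. D x v)"
  shows "Ck (Suc k) f"
proof -
  have "frechet_derivative f (at x) = D x" for x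
    using assms(1) frechet_derivative_at by metis
  then show ?thesis
    using assms by (auto simp: differentiable_def)
qed

lemma Ck_Suc_has_derivative:
  assumes "Ck (Suc k) f"
  shows "(f has_derivative frechet_derivative f (at x)) (at x)"
  using assms frechet_derivative_works by auto

lemma Ck_Suc_derivative: "Ck (Suc k) f \<Longrightarrow> Ck k (\<lambda>x. frechet_derivative f (at x) v)"
  by simp

lemma Ck_SucD: "Ck (Suc k) f \<Longrightarrow> Ck k f"
proof (induction k arbitrary: f)
  case 0
  then show ?case
    by (auto intro!: continuous_at_imp_continuous_on differentiable_imp_continuous_within)
next
  case (Suc k)
  from Suc.prems have "\<And>v. Ck (Suc k) (\<lambda>x. frechet_derivative f (at x) v)" 
    and "\<And>x. f differentiable (at x)"
    by auto
  with Suc.IH show ?case by auto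
qed

lemma Ck_const: "Ck k (\<lambda>x. c)"
  by (induction k arbitrary: c) auto

lemma Ck_bounded_linear:
  assumes "bounded_linear f"
  shows "Ck k f"
proof (cases k)
  case 0
  then show ?thesis
    using assms by (simp add: linear_continuous_on)
next
  case (Suc n)
  show ?thesis unfolding Suc
    by (rule Ck_SucI[where D="\<lambda>_. f"])
      (auto intro: bounded_linear_imp_has_derivative assms Ck_const)
qed

lemma Ck_add: "Ck k f \<Longrightarrow> Ck k g \<Longrightarrow> Ck k (\<lambda>x. f x + g x)"
proof (induction k arbitrary: f g)
  case 0
  then show ?case by (auto intro: continuous_intros)
next
  case (Suc k)
  show ?case
    by (rule Ck_SucI, rule has_derivative_add; (rule Ck_Suc_has_derivative Suc.IH)?)
      (use Suc.prems in auto)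
qed

lemma Ck_mult:
  fixes f g :: "'a::euclidean_space \<Rightarrow> real"
  shows "Ck k f \<Longrightarrow> Ck k g \<Longrightarrow> Ck k (\<lambda>x. f x * g x)"
proof (induction k arbitrary: f g)
  case 0
  then show ?case by (auto intro: continuous_intros)
next
  case (Suc k)
  note D = Suc.prems[THEN Ck_Suc_has_derivative]
  note C = Suc.prems[THEN Ck_Suc_derivative] Suc.prems[THEN Ck_SucD]
  show ?case
    by (rule Ck_SucI[OF has_derivative_mult[OF D]]) (intro Ck_add Suc.IH C)
qed

lemma Ck_compose:
  fixes f :: "'a::euclidean_space \<Rightarrow> real" and h :: "real \<Rightarrow> real"
  shows "Ck k h \<Longrightarrow> Ck k f \<Longrightarrow> Ck k (\<lambda>x. h (f x))"
proof (induction k arbitrary: f h)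
  case 0
  then show ?case using continuous_on_compose2[of UNIV h UNIV f] by simp
next
  case (Suc k)
  let ?h' = "\<lambda>u. frechet_derivative h (at u) 1"
  have h: "(h has_derivative (\<lambda>v. v * ?h' u)) (at u)" for u
  proof -
    note D = Ck_Suc_has_derivative[OF Suc.prems(1), of u]
    have "frechet_derivative h (at u) v = v * ?h' u" for v
      using linear_cmul[OF has_derivative_linear[OF D], of v 1] by simp
    then show ?thesis
      by (intro has_derivative_eq_rhs[OF D] ext)
  qed
  note C = Suc.prems(1)[THEN Ck_Suc_derivative] Suc.prems(2)[THEN Ck_SucD]
  show ?case
    by (rule Ck_SucI[OF has_derivative_compose[OF Ck_Suc_has_derivative[OF Suc.prems(2)] h]])
      (rule Ck_mult[OF Ck_Suc_derivative[OF Suc.prems(2)] Suc.IH[OF C]])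
qed

lemma Ck_inverse:
  fixes f :: "'a::euclidean_space \<Rightarrow> real"
  assumes "\<And>x. f x \<noteq> 0"
  shows "Ck k f \<Longrightarrow> Ck k (\<lambda>x. inverse (f x))"
proof (induction k)
  case 0
  then show ?case using assms by (auto intro: continuous_intros)
next
  case (Suc k)
  have IH: "Ck k (\<lambda>x. inverse (f x))"
    using Suc Ck_SucD by blast
  have D: "((\<lambda>x. inverse (f x)) has_derivative
      (\<lambda>v. (- 1) * (inverse (f x) * frechet_derivative f (at x) v * inverse (f x)))) (at x)" for x
    using Deriv.has_derivative_inverse[OF assms Ck_Suc_has_derivative[OF Suc.prems]] by simp
  show ?case
    by (rule Ck_SucI[OF D]) (intro Ck_mult Ck_const IH Ck_Suc_derivative[OF Suc.prems])
qed

text \<open>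
  The case \<open>k > 0\<close> reduces to \<open>k - 1\<close> because the neighbourhoods are open: there the Frechet
  derivatives of the function and of its local representative agree as well, so the hypothesis
  passes to all directional derivatives.
\<close>
lemma Ck_local:
  assumes "\<And>x. \<exists>U g. open U \<and> x \<in> U \<and> Ck k g \<and> (\<forall>z\<in>U. f z = g z)"
  shows "Ck k f"
  using assms
proof (induction k arbitrary: f)
  case 0
  show ?case unfolding Ck.simps
  proof (intro continuous_at_imp_continuous_on ballI)
    fix x
    obtain U g where U: "open U" "x \<in> U" "continuous_on UNIV g" "\<And>z. z \<in> U \<Longrightarrow> g z = f z"
      using 0[of x] unfolding Ck.simps by metis
    then have "isCont g x" by (simp add: continuous_on_eq_continuous_at)
    moreover have "eventually (\<lambda>z. g z = f z) (nhds x)"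
      using U by (auto simp: eventually_nhds)
    ultimately show "isCont f x"
      using isCont_cong by metis
  qed
next
  case (Suc k)
  have D: "f differentiable at x \<and> frechet_derivative f (at x) = frechet_derivative g (at x)"
    if "open U" "x \<in> U" "Ck (Suc k) g" "\<forall>z\<in>U. f z = g z" for x U g
  proof -
    have "(f has_derivative frechet_derivative g (at x)) (at x)"
      using has_derivative_transform_within_open[OF Ck_Suc_has_derivative[OF that(3)] that(1,2)]
        that(4) by auto
    then show ?thesis
      using differentiable_def frechet_derivative_at by metis
  qed
  have "Ck k (\<lambda>x. frechet_derivative f (at x) v)" for v
  proof (rule Suc.IH)
    fix x
    obtain U g where U: "open U" "x \<in> U" "Ck (Suc k) g" "\<forall>z\<in>U. f z = g z"
      using Suc.prems[of x] by blast
    then show "\<exists>U g. open U \<and> x \<in> U \<and> Ck k g \<and> (\<forall>z\<in>U. frechet_derivative f (at z) v = g z)"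
      using D by (intro exI[of _ U] exI[of _ "\<lambda>z. frechet_derivative g (at z) v"]) auto
  qed
  moreover have "f differentiable at x" for x
    using Suc.prems[of x] D by blast
  ultimately show ?case by simp
qed

lemma C_infinityI: "(\<And>k. Ck k f) \<Longrightarrow> C_infinity f"
  by (simp add: C_infinity_def)

lemma C_infinityD: "C_infinity f \<Longrightarrow> Ck k f"
  by (simp add: C_infinity_def)

lemma C_infinity_const: "C_infinity (\<lambda>x. c)"
  by (intro C_infinityI Ck_const)

lemma C_infinity_bounded_linear: "bounded_linear f \<Longrightarrow> C_infinity f"
  by (intro C_infinityI Ck_bounded_linear)

lemma C_infinity_add: "C_infinity f \<Longrightarrow> C_infinity g \<Longrightarrow> C_infinity (\<lambda>x. f x + g x)"
  by (simp add: C_infinity_def Ck_add)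

lemma C_infinity_mult:
  fixes f g :: "'a::euclidean_space \<Rightarrow> real"
  shows "C_infinity f \<Longrightarrow> C_infinity g \<Longrightarrow> C_infinity (\<lambda>x. f x * g x)"
  by (simp add: C_infinity_def Ck_mult)

lemma C_infinity_diff:
  fixes f g :: "'a::euclidean_space \<Rightarrow> real"
  assumes "C_infinity f" "C_infinity g"
  shows "C_infinity (\<lambda>x. f x - g x)"
  using C_infinity_add[OF assms(1) C_infinity_mult[OF C_infinity_const[of "-1"] assms(2)]] by simp

lemma C_infinity_compose:
  fixes f :: "'a::euclidean_space \<Rightarrow> real" and h :: "real \<Rightarrow> real"
  assumes "C_infinity h" "C_infinity f"
  shows "C_infinity (\<lambda>x. h (f x))"
  by (rule C_infinityI) (rule Ck_compose[OF assms[THEN C_infinityD]])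

lemma C_infinity_inverse:
  fixes f :: "'a::euclidean_space \<Rightarrow> real"
  assumes "C_infinity f" "\<And>x. f x \<noteq> 0"
  shows "C_infinity (\<lambda>x. inverse (f x))"
  by (intro C_infinityI Ck_inverse assms(2) C_infinityD[OF assms(1)])

lemma C_infinity_local:
  assumes "\<And>x. \<exists>U g. open U \<and> x \<in> U \<and> C_infinity g \<and> (\<forall>z\<in>U. f z = g z)"
  shows "C_infinity f"
proof (intro C_infinityI Ck_local)
  fix k x
  show "\<exists>U g. open U \<and> x \<in> U \<and> Ck k g \<and> (\<forall>z\<in>U. f z = g z)"
    using assms[of x] C_infinityD by blast
qed

lemma C_infinity_power:
  fixes f :: "'a::euclidean_space \<Rightarrow> real"
  shows "C_infinity f \<Longrightarrow> C_infinity (\<lambda>x. f x ^ n)"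
  by (induction n) (simp_all add: C_infinity_const C_infinity_mult)

lemma C_infinity_sum:
  assumes "\<And>i. i \<in> A \<Longrightarrow> C_infinity (f i)"
  shows "C_infinity (\<lambda>x. \<Sum>i\<in>A. f i x)"
  using assms
  by (induction A rule: infinite_finite_induct) (simp_all add: C_infinity_const C_infinity_add)

lemma C_infinity_ident: "C_infinity (\<lambda>t::real. t)"
  by (intro C_infinity_bounded_linear bounded_linear_ident)

lemmas C_infinity_intros =
  C_infinity_const C_infinity_ident C_infinity_add C_infinity_diff C_infinity_mult
  C_infinity_power C_infinity_sum

lemma Ck_Suc_if_deriv:
  fixes f :: "real \<Rightarrow> real"
  assumes "\<And>x. (f has_real_derivative f' x) (at x)" "Ck k f'"
  shows "Ck (Suc k) f"
  by (rule Ck_SucI[OF assms(1)[unfolded has_field_derivative_def]])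
    (intro Ck_mult assms(2) Ck_const)

lemma C_infinity_if_deriv:
  fixes f :: "real \<Rightarrow> real"
  assumes "\<And>x. (f has_real_derivative f' x) (at x)" "C_infinity f'"
  shows "C_infinity f"
  using Ck_SucD[OF Ck_Suc_if_deriv[OF assms(1) C_infinityD[OF assms(2)]]]
  by (rule C_infinityI)

lemma
  fixes f :: "real \<Rightarrow> real"
  assumes "C_infinity f"
  shows has_real_derivative_deriv: "(f has_real_derivative deriv f x) (at x)"
    and C_infinity_deriv: "C_infinity (deriv f)"
proof -
  have D: "(f has_derivative frechet_derivative f (at x)) (at x)" for x
    by (rule Ck_Suc_has_derivative[OF C_infinityD[OF assms]])
  have "(f has_real_derivative frechet_derivative f (at x) 1) (at x)" for x
  proof -
    have "frechet_derivative f (at x) v = frechet_derivative f (at x) 1 * v" for v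
    proof -
      have "frechet_derivative f (at x) v = v * frechet_derivative f (at x) 1"
        using linear_cmul[OF has_derivative_linear[OF D], of x v 1] by simp
      then show ?thesis by (simp only: mult.commute)
    qed
    then show ?thesis
      unfolding has_field_derivative_def by (intro has_derivative_eq_rhs[OF D] ext)
  qed
  then have *: "(f has_real_derivative deriv f x) (at x)"
    and eq: "deriv f x = frechet_derivative f (at x) 1" for x
    by (metis DERIV_imp_deriv)+
  show "(f has_real_derivative deriv f x) (at x)" by (rule *)
  have "deriv f = (\<lambda>x. frechet_derivative f (at x) 1)"
    using eq by (rule ext)
  then show "C_infinity (deriv f)"
    using Ck_Suc_derivative[OF C_infinityD[OF assms]] by (simp add: C_infinity_def)
qed

lemma C_infinity_imp_isCont:
  fixes f :: "real \<Rightarrow> real"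
  shows "C_infinity f \<Longrightarrow> isCont f x"
  using has_real_derivative_deriv DERIV_isCont by blast

lemma C_infinity_imp_continuous_on:
  assumes "C_infinity f"
  shows "continuous_on S f"
  using C_infinityD[OF assms, of 0] continuous_on_subset by auto

lemma C_infinity_sin: "C_infinity (sin :: real \<Rightarrow> real)"
proof -
  have "Ck k (sin :: real \<Rightarrow> real) \<and> Ck k (cos :: real \<Rightarrow> real)" for k
  proof (induction k)
    case 0
    then show ?case by (simp add: continuous_on_sin continuous_on_cos continuous_on_id)
  next
    case (Suc k)
    have "Ck k (\<lambda>x::real. (-1) * sin x)"
      using Suc by (intro Ck_mult Ck_const) auto
    then have "Ck k (\<lambda>x::real. - sin x)"
      by simp
    with Suc show ?case
      using Ck_Suc_if_deriv[OF DERIV_sin] Ck_Suc_if_deriv[OF DERIV_cos] by blast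
  qed
  then show ?thesis by (simp add: C_infinity_def)
qed

section \<open>Smooth bump functions\<close>

text \<open>
  The functions \<open>exp (-1/t) / t^n\<close>, extended by \<open>0\<close> to \<open>t \<le> 0\<close>. All exponents are kept because the
  linear span of this family is closed under differentiation, so its smoothness needs no formula
  for higher derivatives.
\<close>
definition flat :: "nat \<Rightarrow> real \<Rightarrow> real" where
  "flat n t = (if 0 < t then inverse t ^ n * exp (- inverse t) else 0)"

lemma flat_tendsto_0: "(flat n \<longlongrightarrow> 0) (at 0)"
proof -
  have "((\<lambda>t. inverse t ^ n / exp (inverse t)) \<longlongrightarrow> (0::real)) (at_right 0)"
    by (rule filterlim_compose[OF tendsto_power_div_exp_0 filterlim_inverse_at_top_right])
  moreover have "\<forall>\<^sub>F t in at_right 0. inverse t ^ n / exp (inverse t) = flat n t"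
    by (auto simp: eventually_at_right_field flat_def exp_minus divide_inverse intro: exI[of _ 1])
  ultimately have "(flat n \<longlongrightarrow> 0) (at_right 0)"
    by (rule Lim_transform_eventually)
  moreover have "(flat n \<longlongrightarrow> 0) (at_left 0)"
    by (rule tendsto_eventually) (auto simp: eventually_at_left_field flat_def intro: exI[of _ "-1"])
  ultimately show ?thesis
    by (simp add: filterlim_at_split)
qed

text \<open>
  At \<open>0\<close> the difference quotient of the \<open>n\<close>-th function is the \<open>(n+1)\<close>-st function, which tends
  to \<open>0\<close>.
\<close>
lemma flat_has_derivative:
  "(flat n has_real_derivative flat (n + 2) t - real n * flat (n + 1) t) (at t)"
proof -
  consider "t > 0" | "t < 0" | "t = 0" by linarith
  then show ?thesis
  proof cases
    case 1
    have "((\<lambda>t. inverse t ^ n * exp (- inverse t)) has_real_derivative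
        flat (n + 2) t - real n * flat (n + 1) t) (at t)"
    proof (cases n)
      case 0
      show ?thesis using 1 unfolding 0
        by (auto intro!: derivative_eq_intros simp: flat_def power2_eq_square)
    next
      case (Suc m)
      show ?thesis using 1 unfolding Suc
        by (auto intro!: derivative_eq_intros simp: flat_def power2_eq_square algebra_simps)
          (cases m; simp)
    qed
    then show ?thesis
      by (rule has_field_derivative_transform_within_open[of _ _ _ "{0<..}"])
        (use 1 in \<open>auto simp: flat_def\<close>)
  next
    case 2
    have "((\<lambda>t. 0) has_real_derivative flat (n + 2) t - real n * flat (n + 1) t) (at t)"
      using 2 by (simp add: flat_def)
    then show ?thesis
      by (rule has_field_derivative_transform_within_open[of _ _ _ "{..<0}"])
        (use 2 in \<open>auto simp: flat_def\<close>)
  next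
    case 3
    have "(flat n z - flat n 0) / (z - 0) = flat (n + 1) z" for z
      by (simp add: flat_def field_simps)
    moreover have "flat m 0 = 0" for m
      by (simp add: flat_def)
    ultimately show ?thesis
      using flat_tendsto_0[of "n + 1"] unfolding 3 has_field_derivative_iff
      by simp
  qed
qed

lemma C_infinity_flat: "C_infinity (flat n)"
proof (rule C_infinityI)
  show "Ck k (flat n)" for k
  proof (induction k arbitrary: n)
    case 0
    show ?case unfolding Ck.simps
      by (rule DERIV_continuous_on[of _ _ "\<lambda>t. flat (n + 2) t - real n * flat (n + 1) t"])
        (rule flat_has_derivative)
  next
    case (Suc k)
    have "Ck k (\<lambda>t. flat (n + 2) t + (- real n) * flat (n + 1) t)"
      by (intro Ck_add Ck_mult Ck_const Suc)
    then show ?case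
      by (intro Ck_Suc_if_deriv[OF flat_has_derivative]) simp
  qed
qed

definition step :: "real \<Rightarrow> real" where
  "step t = flat 0 t * inverse (flat 0 t + flat 0 (1 - t))"

lemma
  shows step_eq_0: "t \<le> 0 \<Longrightarrow> step t = 0"
    and step_eq_1: "1 \<le> t \<Longrightarrow> step t = 1"
  by (auto simp: step_def flat_def)

lemma step_bounds: "0 \<le> step t" "step t \<le> 1"
proof -
  have "0 \<le> flat 0 s" for s by (simp add: flat_def)
  from this[of t] this[of "1 - t"] show "0 \<le> step t" "step t \<le> 1"
    by (auto simp: step_def divide_inverse[symmetric] divide_le_eq_1)
qed

lemma C_infinity_step: "C_infinity step"
proof -
  have "flat 0 t + flat 0 (1 - t) \<noteq> 0" for t
    by (auto simp: flat_def add_nonneg_eq_0_iff)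
  moreover have "C_infinity (\<lambda>t. flat 0 (1 - t))"
    by (rule C_infinity_compose[OF C_infinity_flat]) (intro C_infinity_intros)
  ultimately show ?thesis
    unfolding step_def
    by (intro C_infinity_mult C_infinity_inverse C_infinity_add C_infinity_flat)
qed

text \<open>
  The smooth step is applied to an affine function of the squared distance to the centre, which,
  unlike the distance itself, is smooth at the centre.
\<close>
lemma smooth_bump:
  fixes c :: "'a::euclidean_space"
  assumes "0 < r"
  obtains \<psi> :: "'a \<Rightarrow> real" where "C_infinity \<psi>" "\<And>x. 0 \<le> \<psi> x" "\<And>x. \<psi> x \<le> 1"
    "\<And>x. dist c x \<le> r / 2 \<Longrightarrow> \<psi> x = 1" "\<And>x. r \<le> dist c x \<Longrightarrow> \<psi> x = 0"
proof
  let ?q = "\<lambda>x. \<Sum>b\<in>Basis. (x \<bullet> b - c \<bullet> b) ^ 2"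
  let ?\<psi> = "\<lambda>x. step ((r\<^sup>2 - ?q x) * inverse (r\<^sup>2 - (r / 2)\<^sup>2))"
  have "C_infinity (\<lambda>x::'a. x \<bullet> b)" for b
    by (intro C_infinity_bounded_linear bounded_linear_inner_left)
  then show "C_infinity ?\<psi>"
    by (intro C_infinity_compose[OF C_infinity_step] C_infinity_intros)
  have q: "?q x = (dist c x)\<^sup>2" for x
  proof -
    have "(dist c x)\<^sup>2 = (x - c) \<bullet> (x - c)"
      by (metis dist_commute dist_norm power2_norm_eq_inner)
    then show ?thesis
      unfolding euclidean_inner[of "x - c" "x - c"]
      by (simp add: inner_diff_left power2_eq_square)
  qed
  show "0 \<le> ?\<psi> x" "?\<psi> x \<le> 1" for x
    by (rule step_bounds)+
  have pos: "0 < r\<^sup>2 - (r / 2)\<^sup>2"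
    using assms by (simp add: power2_eq_square)
  show "?\<psi> x = 1" if "dist c x \<le> r / 2" for x
  proof (rule step_eq_1)
    have "(dist c x)\<^sup>2 \<le> (r / 2)\<^sup>2" using that by (intro power_mono) auto
    then show "1 \<le> (r\<^sup>2 - ?q x) * inverse (r\<^sup>2 - (r / 2)\<^sup>2)"
      using pos unfolding q by (simp add: field_simps)
  qed
  show "?\<psi> x = 0" if "r \<le> dist c x" for x
  proof (rule step_eq_0)
    have "r\<^sup>2 \<le> (dist c x)\<^sup>2" using that assms by (intro power_mono) auto
    then show "(r\<^sup>2 - ?q x) * inverse (r\<^sup>2 - (r / 2)\<^sup>2) \<le> 0"
      using pos unfolding q by (simp add: mult_nonpos_nonneg)
  qed
qed

section \<open>Smooth inverse functions and extension of smooth functions\<close>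

text \<open>
  The lower bound on the derivative makes \<open>s\<close> a bijection of the line. The inverse is a \<open>C\<^sup>k\<close>
  function for every \<open>k\<close> by induction, because its derivative is \<open>1 / (s' \<circ> \<tau>)\<close> and thus as regular
  as \<open>\<tau>\<close> itself.
\<close>
lemma C_infinity_inverse_function:
  fixes s :: "real \<Rightarrow> real"
  assumes s: "C_infinity s" and m: "0 < m" "\<And>t. m \<le> deriv s t"
  obtains \<tau> where "C_infinity \<tau>" "\<And>t. \<tau> (s t) = t"
proof -
  have growth: "m * (v - u) \<le> s v - s u" if "u \<le> v" for u v
  proof -
    have "s u - m * u \<le> s v - m * v"
    proof (rule DERIV_nonneg_imp_nondecreasing[OF that])
      fix t
      have "((\<lambda>t. s t - m * t) has_real_derivative deriv s t - m) (at t)"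
        by (auto intro!: derivative_eq_intros has_real_derivative_deriv s)
      with m(2)[of t] show "\<exists>y. ((\<lambda>t. s t - m * t) has_real_derivative y) (at t) \<and> 0 \<le> y"
        by (intro exI[of _ "deriv s t - m"]) auto
    qed
    then show ?thesis by (simp add: algebra_simps)
  qed
  have inj: "inj s"
  proof (rule linorder_injI)
    fix u v :: real assume "u < v"
    then have "0 < m * (v - u)" using m by simp
    with growth[of u v] \<open>u < v\<close> show "s u \<noteq> s v" by simp
  qed
  have "\<exists>t. s t = x" for x
  proof -
    define T where "T = \<bar>x - s 0\<bar> / m"
    have T: "0 \<le> T" "m * T = \<bar>x - s 0\<bar>" using m by (auto simp: T_def)
    have "s (- T) \<le> x" "x \<le> s T"
      using growth[of "- T" 0] growth[of 0 T] T by (auto simp: abs_if split: if_splits)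
    then show ?thesis
      using IVT'[of s "- T" x T] T C_infinity_imp_continuous_on[OF s] by auto
  qed
  then have surj: "surj s" by (metis surjI)
  define \<tau> where "\<tau> = inv s"
  have \<tau>s: "\<tau> (s t) = t" for t
    by (simp add: \<tau>_def inj)
  have s\<tau>: "s (\<tau> x) = x" for x
    by (simp add: \<tau>_def surj surj_f_inv_f)
  have cont: "isCont \<tau> x" for x
    using isCont_inverse_function[of 1 "\<tau> x" \<tau> s] C_infinity_imp_isCont[OF s] \<tau>s s\<tau> by auto
  have deriv: "(\<tau> has_real_derivative inverse (deriv s (\<tau> x))) (at x)" for x
    by (rule DERIV_inverse_function[where f = s and a = "x - 1" and b = "x + 1"])
      (use m(1) m(2)[of "\<tau> x"] s\<tau> cont has_real_derivative_deriv[OF s] in auto)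
  have nz: "deriv s u \<noteq> 0" for u
    using m(1) m(2)[of u] by simp
  have "Ck k \<tau>" for k
  proof (induction k)
    case 0
    show ?case using cont by (simp add: continuous_at_imp_continuous_on)
  next
    case (Suc k)
    show ?case
      by (rule Ck_Suc_if_deriv[OF deriv])
        (rule Ck_inverse[OF nz Ck_compose[OF C_infinityD[OF C_infinity_deriv[OF s]] Suc]])
  qed
  then show thesis
    by (intro that[of \<tau>] C_infinityI \<tau>s)
qed

text \<open>
  The point is that \<open>\<tau>\<close> is smooth on the whole line, so that it can be composed with a coordinate
  of the phase space without domain restrictions. For this \<open>s\<close> is first modified away from \<open>t\<^sub>0\<close>:
  its derivative is cut off to the constant \<open>s' t\<^sub>0\<close>, and an antiderivative of the result is a global
  diffeomorphism that still equals \<open>s\<close> near \<open>t\<^sub>0\<close>.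
\<close>
lemma C_infinity_local_inverse:
  fixes s :: "real \<Rightarrow> real"
  assumes s: "C_infinity s" and "deriv s t\<^sub>0 \<noteq> 0"
  obtains \<eta> \<tau> where "0 < \<eta>" "C_infinity \<tau>" "\<And>t. dist t\<^sub>0 t \<le> \<eta> \<Longrightarrow> \<tau> (s t) = t"
proof -
  have *: "\<exists>\<eta> \<tau>. 0 < \<eta> \<and> C_infinity \<tau> \<and> (\<forall>t. dist t\<^sub>0 t \<le> \<eta> \<longrightarrow> \<tau> (s t) = t)"
    if s: "C_infinity s" and d: "0 < deriv s t\<^sub>0" for s :: "real \<Rightarrow> real"
  proof -
    let ?d = "deriv s t\<^sub>0"
    have "isCont (deriv s) t\<^sub>0"
      by (intro C_infinity_imp_isCont C_infinity_deriv s)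
    then obtain \<delta> where \<delta>: "0 < \<delta>" "\<And>t. dist t\<^sub>0 t < \<delta> \<Longrightarrow> \<bar>deriv s t - ?d\<bar> < ?d / 2"
      using d unfolding continuous_at_eps_delta dist_real_def
      by (metis half_gt_zero abs_minus_commute)
    obtain \<psi> :: "real \<Rightarrow> real" where \<psi>: "C_infinity \<psi>" "\<And>t. 0 \<le> \<psi> t" "\<And>t. \<psi> t \<le> 1"
      "\<And>t. dist t\<^sub>0 t \<le> \<delta> / 2 \<Longrightarrow> \<psi> t = 1" "\<And>t. \<delta> \<le> dist t\<^sub>0 t \<Longrightarrow> \<psi> t = 0"
      using smooth_bump[OF \<delta>(1)] by metis
    define g where "g t = ?d + \<psi> t * (deriv s t - ?d)" for t
    have g: "C_infinity g"
      unfolding g_def by (intro C_infinity_intros \<psi> C_infinity_deriv s)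
    have lower: "?d / 2 \<le> g t" for t
    proof (cases "dist t\<^sub>0 t < \<delta>")
      case True
      then have "\<bar>\<psi> t * (deriv s t - ?d)\<bar> \<le> 1 * (?d / 2)"
        unfolding abs_mult using \<delta>(2)[of t] \<psi>(2,3)[of t] by (intro mult_mono) auto
      then show ?thesis unfolding g_def by linarith
    next
      case False
      then show ?thesis using d \<psi>(5)[of t] by (simp add: g_def)
    qed
    obtain G where G: "\<And>t. (G has_real_derivative g t) (at t)"
      using einterval_antiderivative[of "-\<infinity>" "\<infinity>" g] C_infinity_imp_isCont[OF g]
      by (auto simp: has_real_derivative_iff_has_vector_derivative)
    define S where "S t = G t - G t\<^sub>0 + s t\<^sub>0" for t
    have S: "(S has_real_derivative g t) (at t)" for t
      unfolding S_def by (auto intro!: derivative_eq_intros G)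
    obtain \<tau> where \<tau>: "C_infinity \<tau>" "\<And>t. \<tau> (S t) = t"
      using C_infinity_inverse_function[OF C_infinity_if_deriv[OF S g], of "?d / 2"]
        d lower DERIV_imp_deriv[OF S] by auto
    have "S t = s t" if t: "dist t\<^sub>0 t \<le> \<delta> / 2" for t
    proof -
      let ?B = "cball t\<^sub>0 (\<delta> / 2)"
      have "\<exists>c. \<forall>t\<in>?B. S t - s t = c"
      proof (rule has_field_derivative_zero_constant)
        fix u assume "u \<in> ?B"
        then have "g u - deriv s u = 0" using \<psi>(4)[of u] by (simp add: g_def)
        then show "((\<lambda>t. S t - s t) has_field_derivative 0) (at u within ?B)"
          using DERIV_diff[OF S has_real_derivative_deriv[OF s], of u]
          by (metis has_field_derivative_at_within)
      qed simp
      then have "S t - s t = S t\<^sub>0 - s t\<^sub>0"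
        using t \<delta>(1) by (metis mem_cball centre_in_cball half_gt_zero less_eq_real_def)
      then show ?thesis by (simp add: S_def)
    qed
    then show ?thesis
      using \<tau> \<delta>(1) by (intro exI[of _ "\<delta> / 2"] exI[of _ \<tau>]) (metis half_gt_zero)
  qed
  consider "0 < deriv s t\<^sub>0" | "deriv s t\<^sub>0 < 0"
    using assms(2) by linarith
  then show thesis
  proof cases
    case 1
    then show thesis using *[OF s] that by blast
  next
    case 2
    have D: "((\<lambda>t. - s t) has_real_derivative - deriv s t) (at t)" for t
      by (intro DERIV_minus has_real_derivative_deriv s)
    have neg: "C_infinity (\<lambda>t. - f t)" if "C_infinity f" for f :: "real \<Rightarrow> real"
      using C_infinity_diff[OF C_infinity_const[of 0] that] by simp
    obtain \<eta> \<tau> where "0 < \<eta>" "C_infinity \<tau>" "\<And>t. dist t\<^sub>0 t \<le> \<eta> \<Longrightarrow> \<tau> (- s t) = t"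
      using *[OF neg[OF s]] 2 DERIV_imp_deriv[OF D] by auto
    then show thesis
      using that[of \<eta> "\<lambda>x. \<tau> (- x)"] C_infinity_compose[OF _ neg[OF C_infinity_ident]] by auto
  qed
qed

text \<open>
  Smoothness of \<open>h\<close> on \<open>K\<close> means here that \<open>h\<close> has a smooth extension near each point. The local
  extensions \<open>H\<close> are inserted one at a time, over a finite cover of \<open>K\<close>, by replacing the current
  function \<open>G'\<close> with \<open>G' + \<psi> (H - G')\<close> for a bump function \<open>\<psi>\<close>. On \<open>K\<close> the value \<open>h\<close>
  survives wherever it was attained before, since \<open>H = h\<close> at the points of \<open>K\<close> where \<open>\<psi> \<noteq> 0\<close>.
  This avoids normalising a partition of unity.
\<close>
lemma smooth_extension:
  fixes G h :: "'a::euclidean_space \<Rightarrow> real"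
  assumes G: "C_infinity G" and "compact K" "closed C" "K \<inter> C = {}"
    and loc: "\<And>p. p \<in> K \<Longrightarrow> \<exists>r>0. \<exists>H. C_infinity H \<and> (\<forall>x\<in>K \<inter> ball p r. H x = h x)"
  obtains G' where "C_infinity G'" "\<And>x. x \<in> C \<Longrightarrow> G' x = G x" "\<And>x. x \<in> K \<Longrightarrow> G' x = h x"
proof -
  have "\<exists>r H. 0 < r \<and> ball p r \<inter> C = {} \<and> C_infinity H \<and> (\<forall>x\<in>K \<inter> ball p r. H x = h x)"
    if p: "p \<in> K" for p
  proof -
    obtain r\<^sub>1 H where 1: "0 < r\<^sub>1" "C_infinity H" "\<forall>x\<in>K \<inter> ball p r\<^sub>1. H x = h x"
      using loc[OF p] by blast
    have "p \<in> - C" using p assms(4) by blast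
    then obtain r\<^sub>2 where 2: "0 < r\<^sub>2" "ball p r\<^sub>2 \<subseteq> - C"
      using assms(3) open_contains_ball by blast
    show ?thesis
      using 1 2 by (intro exI[of _ "min r\<^sub>1 r\<^sub>2"] exI[of _ H]) auto
  qed
  then obtain r H where r: "\<And>p. p \<in> K \<Longrightarrow> 0 < r p" "\<And>p. p \<in> K \<Longrightarrow> ball p (r p) \<inter> C = {}"
    and H: "\<And>p. p \<in> K \<Longrightarrow> C_infinity (H p)" "\<And>p x. \<lbrakk>p \<in> K; x \<in> K; x \<in> ball p (r p)\<rbrakk> \<Longrightarrow> H p x = h x"
    by (metis IntI)
  have "K \<subseteq> (\<Union>p\<in>K. ball p (r p / 2))"
    using r(1) by force
  then obtain D where D: "D \<subseteq> K" "finite D" "K \<subseteq> (\<Union>p\<in>D. ball p (r p / 2))"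
    using compactE_image[OF assms(2), of K "\<lambda>p. ball p (r p / 2)"] by auto
  have "\<exists>G'. C_infinity G' \<and> (\<forall>x\<in>C. G' x = G x) \<and>
      (\<forall>x\<in>K. x \<in> (\<Union>p\<in>D. ball p (r p / 2)) \<longrightarrow> G' x = h x)"
    using D(2,1)
  proof (induction D rule: finite_induct)
    case empty
    then show ?case using G by auto
  next
    case (insert p D)
    then obtain G' where G': "C_infinity G'" "\<And>x. x \<in> C \<Longrightarrow> G' x = G x"
      "\<And>x. x \<in> K \<Longrightarrow> x \<in> (\<Union>p\<in>D. ball p (r p / 2)) \<Longrightarrow> G' x = h x"
      by auto
    have p: "p \<in> K" using insert.prems by simp
    obtain \<psi> :: "'a \<Rightarrow> real" where \<psi>: "C_infinity \<psi>"
      "\<And>x. dist p x \<le> r p / 2 \<Longrightarrow> \<psi> x = 1" "\<And>x. r p \<le> dist p x \<Longrightarrow> \<psi> x = 0"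
      using smooth_bump[OF r(1)[OF p]] by metis
    let ?G = "\<lambda>x. G' x + \<psi> x * (H p x - G' x)"
    have "C_infinity ?G"
      by (intro C_infinity_intros G' \<psi> H p)
    moreover have "?G x = G x" if "x \<in> C" for x
    proof -
      have "r p \<le> dist p x" using r(2)[OF p] that by (force simp: not_less[symmetric])
      then show ?thesis using \<psi>(3) G'(2) that by simp
    qed
    moreover have "?G x = h x" if x: "x \<in> K" "x \<in> (\<Union>p\<in>insert p D. ball p (r p / 2))" for x
    proof (cases "x \<in> ball p (r p / 2)")
      case True
      then have "\<psi> x = 1" "x \<in> ball p (r p)"
        using \<psi>(2)[of x] r(1)[OF p] by auto
      then show ?thesis using H(2)[OF p x(1)] by simp
    next
      case False
      then have G'x: "G' x = h x" using x G'(3) by auto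
      show ?thesis
      proof (cases "x \<in> ball p (r p)")
        case True
        then show ?thesis using H(2)[OF p x(1)] G'x by simp
      next
        case False
        then show ?thesis using \<psi>(3)[of x] G'x by simp
      qed
    qed
    ultimately show ?case by blast
  qed
  then show thesis
    using that D(3) by (metis subsetD)
qed

section \<open>Approximation by functions with an injective jet far from the origin\<close>

definition jet :: "(real \<Rightarrow> real) \<Rightarrow> real \<Rightarrow> real^3" where
  "jet y t = vector [y t, deriv y t, deriv (deriv y) t]"

lemma jet_nth:
  "jet y t $ 1 = y t" "jet y t $ 2 = deriv y t" "jet y t $ 3 = deriv (deriv y) t"
  by (simp_all add: jet_def)

lemma continuous_on_jet:
  assumes "C_infinity y"
  shows "continuous_on S (jet y)"
proof -
  have "continuous_on S (\<lambda>t. jet y t $ i)" for i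
    using exhaust_3[of i]
    by (auto simp: jet_nth intro!: C_infinity_imp_continuous_on C_infinity_deriv assms)
  then show ?thesis
    using continuous_on_vec_lambda[of S "\<lambda>i t. jet y t $ i"] by simp
qed

lemma
  fixes y :: "real \<Rightarrow> real"
  assumes y: "C_infinity y"
  shows deriv_add_cubic: "deriv (\<lambda>t. y t + c\<^sub>1 * t + c\<^sub>2 * t\<^sup>2 + c\<^sub>3 * t ^ 3)
      = (\<lambda>t. deriv y t + c\<^sub>1 + 2 * c\<^sub>2 * t + 3 * c\<^sub>3 * t\<^sup>2)" (is "deriv ?z = ?z'")
    and deriv2_add_cubic: "deriv (deriv (\<lambda>t. y t + c\<^sub>1 * t + c\<^sub>2 * t\<^sup>2 + c\<^sub>3 * t ^ 3))
      = (\<lambda>t. deriv (deriv y) t + 2 * c\<^sub>2 + 6 * c\<^sub>3 * t)" (is "_ = ?z''")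
proof -
  have "(?z has_real_derivative ?z' t) (at t)" for t
    by (auto intro!: derivative_eq_intros has_real_derivative_deriv y)
  then show 1: "deriv ?z = ?z'"
    by (intro ext DERIV_imp_deriv)
  have "(?z' has_real_derivative ?z'' t) (at t)" for t
    by (auto intro!: derivative_eq_intros has_real_derivative_deriv C_infinity_deriv y)
  then show "deriv (deriv ?z) = ?z''"
    unfolding 1 by (intro ext DERIV_imp_deriv)
qed

text \<open>
  A dimension count. For \<open>s \<noteq> t\<close> the equation between the jets at \<open>s\<close> and \<open>t\<close> of the perturbed
  function is linear in the three coefficients, and triangular with diagonal entries \<open>s - t\<close>,
  \<open>2 (s - t)\<close>, \<open>6 (s - t)\<close>. So each pair \<open>(s, t)\<close> excludes exactly one coefficient vector \<open>\<Phi> (s, t)\<close>,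
  and the excluded vectors form a differentiable image of a two-dimensional set, which is negligible
  in three-dimensional space.
\<close>
lemma injective_jet_perturbation:
  fixes y :: "real \<Rightarrow> real"
  assumes y: "C_infinity y" and "0 < e"
  obtains c\<^sub>1 c\<^sub>2 c\<^sub>3 where "\<bar>c\<^sub>1\<bar> < e" "\<bar>c\<^sub>2\<bar> < e" "\<bar>c\<^sub>3\<bar> < e"
    "inj (jet (\<lambda>t. y t + c\<^sub>1 * t + c\<^sub>2 * t\<^sup>2 + c\<^sub>3 * t ^ 3))"
proof -
  define y1 where "y1 = deriv y"
  define y2 where "y2 = deriv y1"
  have y1: "C_infinity y1" and y2: "C_infinity y2"
    using y by (auto simp: y1_def y2_def intro: C_infinity_deriv)
  define C3 where "C3 = (\<lambda>(s, t). - (y2 s - y2 t) / (6 * (s - t)))"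
  define C2 where "C2 = (\<lambda>(s, t). - (y1 s - y1 t + 3 * C3 (s, t) * (s\<^sup>2 - t\<^sup>2)) / (2 * (s - t)))"
  define C1 where "C1 = (\<lambda>(s, t). - (y s - y t + C2 (s, t) * (s\<^sup>2 - t\<^sup>2)
                                  + C3 (s, t) * (s ^ 3 - t ^ 3)) / (s - t))"
  define \<Phi> where "\<Phi> p = (C1 p, C2 p, C3 p)" for p
  define S where "S = {p :: real \<times> real. fst p \<noteq> snd p}"
  have "\<Phi> differentiable (at p)" if "p \<in> S" for p
  proof -
    have fst_snd: "(fst :: real \<times> real \<Rightarrow> real) differentiable (at p)"
      "(snd :: real \<times> real \<Rightarrow> real) differentiable (at p)"
      by (auto intro: bounded_linear_imp_differentiable bounded_linear_fst bounded_linear_snd)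
    have comp: "(\<lambda>p. f (fst p)) differentiable (at p)" "(\<lambda>p. f (snd p)) differentiable (at p)"
      if "C_infinity f" for f :: "real \<Rightarrow> real"
      using DERIV_compose_FDERIV[OF has_real_derivative_deriv[OF that] has_derivative_fst[OF has_derivative_ident]]
        DERIV_compose_FDERIV[OF has_real_derivative_deriv[OF that] has_derivative_snd[OF has_derivative_ident]]
      by (blast intro: differentiableI)+
    have "fst p - snd p \<noteq> 0" using that by (simp add: S_def)
    note dI = differentiable_add differentiable_diff differentiable_mult differentiable_divide
      differentiable_minus differentiable_power differentiable_const comp[OF y] comp[OF y1]
      comp[OF y2] fst_snd
    have 3: "C3 differentiable (at p)"
      unfolding C3_def case_prod_beta by (intro dI) (use that in \<open>auto simp: S_def\<close>)
    have 2: "C2 differentiable (at p)"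
      unfolding C2_def case_prod_beta prod.collapse
      by (intro dI 3) (use that in \<open>auto simp: S_def\<close>)
    have 1: "C1 differentiable (at p)"
      unfolding C1_def case_prod_beta prod.collapse
      by (intro dI 2 3) (use that in \<open>auto simp: S_def\<close>)
    show ?thesis
      using 1 2 3 unfolding differentiable_def \<Phi>_def
      by (elim exE) (rule exI, rule has_derivative_Pair[OF _ has_derivative_Pair])
  qed
  then have "negligible (\<Phi> ` S)"
    by (intro negligible_differentiable_image_lowdim)
      (auto simp: differentiable_on_def intro: differentiable_at_withinI)
  moreover have "\<not> negligible (ball (0 :: real \<times> real \<times> real) e)"
    using assms(2) by (intro open_not_negligible) auto
  ultimately have "\<not> ball 0 e \<subseteq> \<Phi> ` S"
    using negligible_subset by metis
  then obtain c where c: "c \<in> ball 0 e" "c \<notin> \<Phi> ` S"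
    by blast
  obtain c1 c2 c3 where c_eq: "c = (c1, c2, c3)" by (cases c)
  have small: "\<bar>c1\<bar> < e" "\<bar>c2\<bar> < e" "\<bar>c3\<bar> < e"
    using c(1) norm_fst_le[of c1 "(c2, c3)"] norm_snd_le[of "(c2, c3)" c1]
      norm_fst_le[of c2 c3] norm_snd_le[of c3 c2] unfolding c_eq by auto
  let ?z = "\<lambda>t. y t + c1 * t + c2 * t\<^sup>2 + c3 * t ^ 3"
  have "inj (jet ?z)"
  proof (rule injI, rule ccontr)
    fix s t assume eq: "jet ?z s = jet ?z t" and "s \<noteq> t"
    have e0: "y s + c1 * s + c2 * s\<^sup>2 + c3 * s ^ 3 = y t + c1 * t + c2 * t\<^sup>2 + c3 * t ^ 3"
      using arg_cong[OF eq, of "\<lambda>v. v $ 1"] by (simp add: jet_nth)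
    have e1: "y1 s + c1 + 2 * c2 * s + 3 * c3 * s\<^sup>2 = y1 t + c1 + 2 * c2 * t + 3 * c3 * t\<^sup>2"
      using arg_cong[OF eq, of "\<lambda>v. v $ 2"] by (simp add: jet_nth deriv_add_cubic[OF y] y1_def)
    have e2: "y2 s + 2 * c2 + 6 * c3 * s = y2 t + 2 * c2 + 6 * c3 * t"
      using arg_cong[OF eq, of "\<lambda>v. v $ 3"]
      by (simp add: jet_nth deriv2_add_cubic[OF y] y1_def y2_def)
    have nz: "s - t \<noteq> 0" using \<open>s \<noteq> t\<close> by simp
    have 3: "C3 (s, t) = c3"
      using e2 nz unfolding C3_def by (simp add: divide_eq_eq) argo
    have 2: "C2 (s, t) = c2"
      using e1 nz unfolding C2_def by (simp add: divide_eq_eq 3) argo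
    have 1: "C1 (s, t) = c1"
      using e0 nz unfolding C1_def by (simp add: divide_eq_eq 2 3) argo
    have "c = \<Phi> (s, t)" "(s, t) \<in> S"
      using 1 2 3 \<open>s \<noteq> t\<close> by (auto simp: \<Phi>_def c_eq S_def)
    with c(2) show False by blast
  qed
  with small show thesis by (rule that)
qed

text \<open>
  Adding \<open>\<delta> sin (\<omega> t)\<close> with small \<open>\<delta>\<close> and large \<open>\<omega>\<close> hardly changes the function, but pushes the pair
  of its first two derivatives far away from the origin, since sine and cosine are never small
  together. The cubic perturbation that makes the jet injective is taken so small that it disturbs
  none of these estimates.
\<close>
lemma oscillating_approximation:
  fixes p :: "real \<Rightarrow> real"
  assumes p: "C_infinity p" and "0 < e"
  obtains y where "C_infinity y" "\<And>t. t \<in> {a..b} \<Longrightarrow> \<bar>y t - p t\<bar> \<le> e"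
    "\<And>t. t \<in> {a..b} \<Longrightarrow> R < \<bar>deriv y t\<bar> \<or> R < \<bar>deriv (deriv y) t\<bar>"
    "inj (jet y)"
proof -
  have bdd: "\<exists>M. \<forall>t\<in>{a..b}. \<bar>f t\<bar> \<le> M" if "C_infinity f" for f :: "real \<Rightarrow> real"
  proof -
    have "bounded (f ` {a..b})"
      by (intro compact_imp_bounded compact_continuous_image C_infinity_imp_continuous_on that) simp
    then show ?thesis by (simp add: bounded_iff)
  qed
  obtain M\<^sub>1 M\<^sub>2 where "\<forall>t\<in>{a..b}. \<bar>deriv p t\<bar> \<le> M\<^sub>1" "\<forall>t\<in>{a..b}. \<bar>deriv (deriv p) t\<bar> \<le> M\<^sub>2"
    using bdd[OF C_infinity_deriv[OF p]] bdd[OF C_infinity_deriv[OF C_infinity_deriv[OF p]]] by auto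
  then obtain M where M: "0 \<le> M" "\<And>t. t \<in> {a..b} \<Longrightarrow> \<bar>deriv p t\<bar> \<le> M"
      "\<And>t. t \<in> {a..b} \<Longrightarrow> \<bar>deriv (deriv p) t\<bar> \<le> M"
    using that[of "max 0 (max M\<^sub>1 M\<^sub>2)"] by fastforce
  define \<delta> where "\<delta> = e / 2"
  \<comment> \<open>large enough for \<open>\<delta> \<omega> / 2\<close> to dominate \<open>R\<close>, the derivatives of \<open>p\<close> and an error of \<open>1\<close> from the cubic\<close>
  define \<omega> where "\<omega> = 1 + 2 * (\<bar>R\<bar> + M + 1) / \<delta>"
  have \<delta>: "0 < \<delta>" using assms(2) by (simp add: \<delta>_def)
  have \<omega>: "1 \<le> \<omega>" "\<bar>R\<bar> + M + 1 < \<delta> * \<omega> / 2"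
    using \<delta> M(1) by (auto simp: \<omega>_def field_simps)
  define z where "z t = p t + \<delta> * sin (\<omega> * t)" for t
  have z: "C_infinity z"
    unfolding z_def by (intro C_infinity_intros p C_infinity_compose[OF C_infinity_sin])
  have z': "deriv z t = deriv p t + \<delta> * \<omega> * cos (\<omega> * t)" for t
    unfolding z_def
    by (rule DERIV_imp_deriv) (auto intro!: derivative_eq_intros has_real_derivative_deriv p)
  have z'': "deriv (deriv z) t = deriv (deriv p) t - \<delta> * \<omega>\<^sup>2 * sin (\<omega> * t)" for t
    unfolding z'[abs_def]
    by (rule DERIV_imp_deriv)
      (auto intro!: derivative_eq_intros has_real_derivative_deriv C_infinity_deriv p
        simp: power2_eq_square)
  define B where "B = 1 + \<bar>a\<bar> + \<bar>b\<bar>"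
  have B: "1 \<le> B" "\<And>t. t \<in> {a..b} \<Longrightarrow> \<bar>t\<bar> \<le> B"
    by (auto simp: B_def)
  \<comment> \<open>the cubic and its first two derivatives are sums of monomials bounded by \<open>\<eta> B\<^sup>3\<close>, with total weight at most \<open>8\<close>\<close>
  define \<eta> where "\<eta> = min 1 (e / 2) / (8 * B ^ 3)"
  have "0 < B ^ 3" using B(1) by simp
  then have \<eta>: "0 < \<eta>" "8 * (\<eta> * B ^ 3) \<le> 1" "8 * (\<eta> * B ^ 3) \<le> e / 2"
    using assms(2) by (auto simp: \<eta>_def)
  obtain c\<^sub>1 c\<^sub>2 c\<^sub>3 where c: "\<bar>c\<^sub>1\<bar> < \<eta>" "\<bar>c\<^sub>2\<bar> < \<eta>" "\<bar>c\<^sub>3\<bar> < \<eta>"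
    "inj (jet (\<lambda>t. z t + c\<^sub>1 * t + c\<^sub>2 * t\<^sup>2 + c\<^sub>3 * t ^ 3))"
    by (rule injective_jet_perturbation[OF z \<eta>(1)]) blast
  let ?y = "\<lambda>t. z t + c\<^sub>1 * t + c\<^sub>2 * t\<^sup>2 + c\<^sub>3 * t ^ 3"
  have mon: "\<bar>k * t ^ j\<bar> \<le> \<eta> * B ^ 3" if "\<bar>k\<bar> < \<eta>" "t \<in> {a..b}" "j \<le> 3" for k t j
  proof -
    have "\<bar>t\<bar> ^ j \<le> B ^ j" using B(2)[OF that(2)] by (intro power_mono) auto
    also have "\<dots> \<le> B ^ 3" using B(1) that(3) by (intro power_increasing)
    finally show ?thesis
      using that(1) \<eta>(1) unfolding abs_mult power_abs by (intro mult_mono) auto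
  qed
  show thesis
  proof (rule that[OF _ _ _ c(4)])
    show "C_infinity ?y"
      by (intro C_infinity_intros z)
  next
    fix t assume t: "t \<in> {a..b}"
    have "\<bar>\<delta> * sin (\<omega> * t)\<bar> \<le> \<delta>"
      using \<delta> by (simp add: abs_mult mult_left_le)
    moreover have "\<bar>c\<^sub>1 * t\<bar> \<le> \<eta> * B ^ 3" "\<bar>c\<^sub>2 * t\<^sup>2\<bar> \<le> \<eta> * B ^ 3" "\<bar>c\<^sub>3 * t ^ 3\<bar> \<le> \<eta> * B ^ 3"
      using mon[OF c(1) t, of 1] mon[OF c(2) t, of 2] mon[OF c(3) t, of 3] by auto
    ultimately show "\<bar>?y t - p t\<bar> \<le> e"
      using \<eta>(3) unfolding z_def \<delta>_def abs_le_iff by argo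
  next
    fix t assume t: "t \<in> {a..b}"
    have c0: "\<bar>c\<^sub>1\<bar> \<le> \<eta> * B ^ 3" "\<bar>c\<^sub>2\<bar> \<le> \<eta> * B ^ 3" "\<bar>c\<^sub>2 * t\<bar> \<le> \<eta> * B ^ 3"
        "\<bar>c\<^sub>3 * t\<bar> \<le> \<eta> * B ^ 3" "\<bar>c\<^sub>3 * t\<^sup>2\<bar> \<le> \<eta> * B ^ 3"
      using mon[OF c(1) t, of 0] mon[OF c(2) t, of 0] mon[OF c(2) t, of 1] mon[OF c(3) t, of 1]
        mon[OF c(3) t, of 2] by auto
    have d1: "\<bar>deriv ?y t - \<delta> * \<omega> * cos (\<omega> * t)\<bar> \<le> M + 1"
      using c0 \<eta>(2) M(2)[OF t] unfolding deriv_add_cubic[OF z] z' abs_le_iff by argo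
    have d2: "\<bar>deriv (deriv ?y) t + \<delta> * \<omega>\<^sup>2 * sin (\<omega> * t)\<bar> \<le> M + 1"
      using c0 \<eta>(2) M(3)[OF t] unfolding deriv2_add_cubic[OF z] z'' abs_le_iff by argo
    have "1 / 2 \<le> \<bar>cos (\<omega> * t)\<bar> \<or> 1 / 2 \<le> \<bar>sin (\<omega> * t)\<bar>"
    proof (rule ccontr)
      assume "\<not> ?thesis"
      then have "\<bar>cos (\<omega> * t)\<bar> < 1 / 2" "\<bar>sin (\<omega> * t)\<bar> < 1 / 2"
        by simp_all
      from this[THEN power_strict_mono, of 2]
      have "\<bar>cos (\<omega> * t)\<bar>\<^sup>2 < (1 / 2)\<^sup>2" "\<bar>sin (\<omega> * t)\<bar>\<^sup>2 < (1 / 2)\<^sup>2"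
        by simp_all
      then show False
        using sin_cos_squared_add[of "\<omega> * t"] by (simp add: power2_eq_square)
    qed
    then show "R < \<bar>deriv ?y t\<bar> \<or> R < \<bar>deriv (deriv ?y) t\<bar>"
    proof
      assume "1 / 2 \<le> \<bar>cos (\<omega> * t)\<bar>"
      then have "\<delta> * \<omega> * (1 / 2) \<le> \<bar>\<delta> * \<omega> * cos (\<omega> * t)\<bar>"
        using \<delta> \<omega>(1) by (simp add: abs_mult)
      then show ?thesis using d1 \<omega>(2) by linarith
    next
      assume "1 / 2 \<le> \<bar>sin (\<omega> * t)\<bar>"
      then have "\<delta> * \<omega>\<^sup>2 * (1 / 2) \<le> \<delta> * \<omega>\<^sup>2 * \<bar>sin (\<omega> * t)\<bar>"
        using \<delta> by (intro mult_left_mono) auto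
      also have "\<dots> = \<bar>\<delta> * \<omega>\<^sup>2 * sin (\<omega> * t)\<bar>"
        using \<delta> by (simp add: abs_mult)
      finally have "\<delta> * \<omega>\<^sup>2 * (1 / 2) \<le> \<bar>\<delta> * \<omega>\<^sup>2 * sin (\<omega> * t)\<bar>" .
      moreover have "\<delta> * \<omega> \<le> \<delta> * \<omega>\<^sup>2"
        using \<delta> \<omega>(1) by (simp add: power2_eq_square)
      ultimately show ?thesis using d2 \<omega>(2) by linarith
    qed
  qed
qed

text \<open>
  Any smooth right-hand side can be changed outside a given ball so as to acquire a solution near
  \<open>p\<close>. The jet of the oscillating approximation \<open>y\<close> runs outside the ball, is injective, and is
  immersed because \<open>y'\<close> or \<open>y''\<close> is nonzero; so \<open>y'''\<close> is locally a smooth function of one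
  coordinate of the jet, and it extends from the curve to the whole space. The solution survives
  every later change outside the larger ball of radius \<open>R'\<close>.
\<close>
lemma prescribe_approximate_solution:
  fixes G :: "real^3 \<Rightarrow> real" and p :: "real \<Rightarrow> real"
  assumes G: "C_infinity G" and p: "C_infinity p" and "0 < e"
  obtains G' R' y where "C_infinity G'" "\<And>x. x \<in> cball 0 R \<Longrightarrow> G' x = G x" "R + 1 \<le> R'"
    "\<And>t. t \<in> {a..b} \<Longrightarrow> \<bar>y t - p t\<bar> \<le> e"
    "\<And>F. (\<And>x. x \<in> cball 0 R' \<Longrightarrow> F x = G' x) \<Longrightarrow> is_solution a b F y"
proof -
  obtain y where y: "C_infinity y" "\<And>t. t \<in> {a..b} \<Longrightarrow> \<bar>y t - p t\<bar> \<le> e"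
    and large: "\<And>t. t \<in> {a..b} \<Longrightarrow> \<bar>R\<bar> < \<bar>deriv y t\<bar> \<or> \<bar>R\<bar> < \<bar>deriv (deriv y) t\<bar>"
    and inj: "inj (jet y)"
    using oscillating_approximation[OF p assms(3)] by metis
  note y' = C_infinity_deriv[OF y(1)]
  note y'' = C_infinity_deriv[OF y']
  let ?y3 = "deriv (deriv (deriv y))"
  define K where "K = jet y ` {a..b}"
  have K: "compact K"
    unfolding K_def by (intro compact_continuous_image continuous_on_jet y(1)) simp
  have "norm (jet y t) > R" if "t \<in> {a..b}" for t
    using large[OF that] component_le_norm_cart[of "jet y t" 2] component_le_norm_cart[of "jet y t" 3]
    by (auto simp: jet_nth)
  then have disj: "K \<inter> cball 0 R = {}"
    by (force simp: K_def)
  define h where "h = ?y3 \<circ> inv (jet y)"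
  have h: "h (jet y t) = ?y3 t" for t
    by (simp add: h_def inj)
  have loc: "\<exists>r>0. \<exists>H. C_infinity H \<and> (\<forall>x\<in>K \<inter> ball q r. H x = h x)" if "q \<in> K" for q
  proof -
    obtain t\<^sub>0 where t\<^sub>0: "t\<^sub>0 \<in> {a..b}" "q = jet y t\<^sub>0"
      using \<open>q \<in> K\<close> by (auto simp: K_def)
    obtain s and i :: 3 where s: "C_infinity s" "deriv s t\<^sub>0 \<noteq> 0" "\<And>t. jet y t $ i = s t"
      using large[OF t\<^sub>0(1)]
    proof
      assume "\<bar>R\<bar> < \<bar>deriv y t\<^sub>0\<bar>"
      then show thesis using that[of y 1] y(1) by (auto simp: jet_nth)
    next
      assume "\<bar>R\<bar> < \<bar>deriv (deriv y) t\<^sub>0\<bar>"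
      then show thesis using that[of "deriv y" 2] y' by (auto simp: jet_nth)
    qed
    obtain \<eta> \<tau> where \<eta>: "0 < \<eta>" "C_infinity \<tau>" "\<And>t. dist t\<^sub>0 t \<le> \<eta> \<Longrightarrow> \<tau> (s t) = t"
      using C_infinity_local_inverse[OF s(1,2)] by metis
    \<comment> \<open>injectivity keeps the rest of the curve away from \<open>q\<close>, so that a small ball meets only the arc on which \<open>\<tau>\<close> inverts \<open>s\<close>\<close>
    let ?K' = "jet y ` ({a..b} - ball t\<^sub>0 \<eta>)"
    have "compact ?K'"
      by (intro compact_continuous_image continuous_on_jet y(1) compact_diff) auto
    then have "open (- ?K')"
      by (simp add: compact_imp_closed open_Compl)
    moreover have "q \<in> - ?K'"
      using inj \<eta>(1) by (auto simp: t\<^sub>0 inj_eq)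
    ultimately obtain r where r: "0 < r" "ball q r \<subseteq> - ?K'"
      using openE by blast
    let ?H = "\<lambda>x. ?y3 (\<tau> (x $ i))"
    have "C_infinity ?H"
      by (rule C_infinity_compose[OF C_infinity_deriv[OF y'']],
          rule C_infinity_compose[OF \<eta>(2)],
          rule C_infinity_bounded_linear, rule bounded_linear_vec_nth)
    moreover have "?H x = h x" if x: "x \<in> K \<inter> ball q r" for x
    proof -
      obtain t where t: "t \<in> {a..b}" "x = jet y t"
        using x by (auto simp: K_def)
      with x r(2) have "t \<in> ball t\<^sub>0 \<eta>" by blast
      then show ?thesis using \<eta>(3)[of t] by (simp add: t s(3) h)
    qed
    ultimately show ?thesis using r(1) by blast
  qed
  obtain G' where G': "C_infinity G'" "\<And>x. x \<in> cball 0 R \<Longrightarrow> G' x = G x"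
    "\<And>x. x \<in> K \<Longrightarrow> G' x = h x"
    by (rule smooth_extension[OF G K closed_cball disj loc]) blast+
  obtain N where N: "\<And>x. x \<in> K \<Longrightarrow> norm x \<le> N"
    using compact_imp_bounded[OF K] by (auto simp: bounded_iff)
  show thesis
  proof (rule that[of G' "max N (R + 1)" y])
    fix F assume F: "\<And>x. x \<in> cball 0 (max N (R + 1)) \<Longrightarrow> F x = G' x"
    have "F (jet y t) = ?y3 t" if "t \<in> {a..b}" for t
    proof -
      have "jet y t \<in> K" using that by (simp add: K_def)
      then show ?thesis using F[of "jet y t"] N[of "jet y t"] G'(3) h by auto
    qed
    then show "is_solution a b F y"
      unfolding is_solution_def jet_def
      by (intro exI[of _ "deriv y"] exI[of _ "deriv (deriv y)"])
        (simp add: has_field_derivative_at_within has_real_derivative_deriv y y' y'')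
  qed (use G' y in auto)
qed

section \<open>Density of the solutions\<close>

text \<open>
  Bernstein polynomials transported to \<open>[a,b]\<close>, with the values at the nodes replaced by
  rational numbers: the Bernstein basis is nonnegative with sum \<open>1\<close>, so rounding the coefficients
  by less than \<open>e / 2\<close> moves the polynomial by at most \<open>e / 2\<close>, and only countably many
  coefficient lists remain.
\<close>
lemma smooth_dense_sequence:
  fixes a b :: real
  assumes "a < b"
  shows "\<exists>p :: nat \<Rightarrow> real \<Rightarrow> real. (\<forall>n. C_infinity (p n)) \<and>
    (\<forall>f e. continuous_on {a..b} f \<longrightarrow> 0 < e \<longrightarrow> (\<exists>n. \<forall>t\<in>{a..b}. \<bar>f t - p n t\<bar> < e))"
proof -
  define B where "B qs t = (\<Sum>k\<le>length qs - 1.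
      of_rat (qs ! k) * Bernstein (length qs - 1) k ((t - a) * inverse (b - a)))"
    for qs :: "rat list" and t
  have "C_infinity (B qs)" for qs
    unfolding B_def[abs_def] Bernstein_def by (intro C_infinity_intros)
  moreover have "\<exists>n. \<forall>t\<in>{a..b}. \<bar>f t - B (from_nat n) t\<bar> < e"
    if f: "continuous_on {a..b} f" and e: "0 < e" for f e
  proof -
    define g where "g x = f (a + (b - a) * x)" for x
    have "continuous_on {0..1} g"
      unfolding g_def
    proof (intro continuous_on_compose2[OF f] continuous_intros subsetI)
      fix u assume "u \<in> (\<lambda>x. a + (b - a) * x) ` {0..1}"
      then obtain x where x: "u = a + (b - a) * x" "x \<in> {0..1}" by blast
      then have "(b - a) * x \<le> b - a" "0 \<le> (b - a) * x"
        using assms by (auto intro: mult_left_le)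
      then show "u \<in> {a..b}" using x(1) by simp
    qed
    then obtain N where N: "\<And>x. x \<in> {0..1} \<Longrightarrow>
        \<bar>g x - (\<Sum>k\<le>N. g (k / N) * Bernstein N k x)\<bar> < e / 2"
      using Bernstein_Weierstrass[of g "e / 2"] e by auto
    have "\<exists>q. \<bar>of_rat q - g (real k / real N)\<bar> < e / 2" for k
    proof -
      obtain q where "g (k / N) < of_rat q" "of_rat q < g (k / N) + e / 2"
        using of_rat_dense[of "g (k / N)" "g (k / N) + e / 2"] e by auto
      then show ?thesis by (intro exI[of _ q]) auto
    qed
    then obtain q where q: "\<And>k. \<bar>of_rat (q k) - g (real k / real N)\<bar> < e / 2"
      by metis
    define qs where "qs = map q [0..<Suc N]"
    have len: "length qs = Suc N" by (simp add: qs_def)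
    have nth: "qs ! k = q k" if "k \<le> N" for k
      using that unfolding qs_def by (subst nth_map) (auto simp del: upt_Suc)
    have "\<bar>f t - B qs t\<bar> < e" if t: "t \<in> {a..b}" for t
    proof -
      define x where "x = (t - a) * inverse (b - a)"
      have x: "x \<in> {0..1}" "a + (b - a) * x = t"
        using t assms by (auto simp: x_def field_simps)
      have "\<bar>(\<Sum>k\<le>N. g (k / N) * Bernstein N k x) - (\<Sum>k\<le>N. of_rat (q k) * Bernstein N k x)\<bar>
          \<le> (\<Sum>k\<le>N. \<bar>(g (k / N) - of_rat (q k)) * Bernstein N k x\<bar>)"
        unfolding sum_subtractf[symmetric] left_diff_distrib[symmetric] by (rule sum_abs)
      also have "\<dots> \<le> (\<Sum>k\<le>N. e / 2 * Bernstein N k x)"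
      proof (rule sum_mono)
        fix k
        have "0 \<le> Bernstein N k x" using x(1) by (intro Bernstein_nonneg) auto
        then show "\<bar>(g (k / N) - of_rat (q k)) * Bernstein N k x\<bar> \<le> e / 2 * Bernstein N k x"
          using q[of k] e unfolding abs_mult
            by (intro mult_mono) (auto simp: abs_minus_commute)
      qed
      also have "\<dots> = e / 2"
        by (simp only: sum_distrib_left[symmetric] sum_Bernstein mult_1_right)
      finally have "\<bar>(\<Sum>k\<le>N. g (k / N) * Bernstein N k x) - B qs t\<bar> \<le> e / 2"
        by (simp add: B_def len x_def nth)
      moreover have "g x = f t"
        using x(2) by (simp add: g_def)
      ultimately show ?thesis
        using N[OF x(1)] by linarith
    qed
    then show ?thesis
      by (intro exI[of _ "to_nat qs"]) simp
  qed
  ultimately show ?thesis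
    by (intro exI[of _ "\<lambda>n. B (from_nat n)"]) simp
qed

text \<open>
  Near each point the sequence is eventually constant, so its limit is locally one of its members.
\<close>
lemma glue_exhaustion:
  fixes G :: "nat \<Rightarrow> 'a::euclidean_space \<Rightarrow> 'b::real_normed_vector"
  assumes smooth: "\<And>n. C_infinity (G n)"
    and R: "\<And>n. real n \<le> R n" "\<And>n. R n \<le> R (Suc n)"
    and agree: "\<And>n x. x \<in> cball 0 (R n) \<Longrightarrow> G (Suc n) x = G n x"
  obtains F where "C_infinity F" "\<And>n x. x \<in> cball 0 (R n) \<Longrightarrow> F x = G n x"
proof -
  have later: "G m x = G n x" if "n \<le> m" "x \<in> cball 0 (R n)" for m n x
    using that(1)
  proof (induction m rule: dec_induct)
    case (step m)
    have "R n \<le> R m"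
      using lift_Suc_mono_le[of R] R(2) step.hyps(1) by blast
    then show ?case using step.IH agree[of x m] that(2) by simp
  qed simp
  define F where "F x = G (nat \<lceil>norm x\<rceil>) x" for x
  have F: "F x = G n x" if "x \<in> cball 0 (R n)" for n x
  proof -
    let ?m = "nat \<lceil>norm x\<rceil>"
    have "norm x \<le> R ?m" using R(1)[of ?m] by linarith
    then have x: "x \<in> cball 0 (R ?m)" by simp
    show ?thesis
    proof (cases "n \<le> ?m")
      case True
      then show ?thesis unfolding F_def using that by (rule later)
    next
      case False
      then have "?m \<le> n" by linarith
      then show ?thesis unfolding F_def using x by (rule later[symmetric])
    qed
  qed
  have "C_infinity F"
  proof (rule C_infinity_local)
    fix x :: 'a
    let ?n = "nat \<lceil>norm x\<rceil> + 1"
    have "x \<in> ball 0 (real ?n)" by simp linarith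
    moreover have "F z = G ?n z" if "z \<in> ball 0 (real ?n)" for z
      using F[of z ?n] R(1)[of ?n] that by simp
    ultimately show "\<exists>U g. open U \<and> x \<in> U \<and> C_infinity g \<and> (\<forall>z\<in>U. F z = g z)"
      using smooth open_ball by blast
  qed
  then show thesis using F by (rule that)
qed

lemma is_solution_restrict:
  assumes "is_solution a b F y"
  shows "is_solution a b F (restrict y {a..b})"
proof -
  have *: "(restrict y {a..b} has_real_derivative D) (at t within {a..b})"
    if "(y has_real_derivative D) (at t within {a..b})" "t \<in> {a..b}" for D t
    using that by (rule has_field_derivative_transform_within[OF _ zero_less_one]) auto
  show ?thesis
    using assms * unfolding is_solution_def by (metis restrict_apply')
qed

theorem mainTheorem1:
  fixes a b :: real
  assumes "a < b"
  shows "\<exists>F :: real^3 \<Rightarrow> real. C_infinity F \<and>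
           mtopology_of (C0 a b) closure_of solutions a b F = mspace (C0 a b)"
proof -
  obtain p :: "nat \<Rightarrow> real \<Rightarrow> real" where p: "\<forall>n. C_infinity (p n)"
    and dense: "\<forall>f e. continuous_on {a..b} f \<longrightarrow> 0 < e \<longrightarrow> (\<exists>n. \<forall>t\<in>{a..b}. \<bar>f t - p n t\<bar> < e)"
    using smooth_dense_sequence[OF assms] by blast
  \<comment> \<open>stage \<open>n\<close> encodes a target of the dense sequence together with a tolerance\<close>
  define i where "i n = fst (prod_decode n)" for n
  define \<epsilon> where "\<epsilon> n = inverse (real (Suc (snd (prod_decode n))))" for n
  define good where "good n G R y \<longleftrightarrow> (\<forall>t\<in>{a..b}. \<bar>y t - p (i n) t\<bar> \<le> \<epsilon> n) \<and>
      (\<forall>F. (\<forall>x\<in>cball 0 R. F x = G x) \<longrightarrow> is_solution a b F y)"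
    for n and G :: "real^3 \<Rightarrow> real" and R :: real and y
  have "\<exists>X. \<forall>n. (C_infinity (fst (X n)) \<and> real n \<le> snd (X n)) \<and>
      ((\<forall>x\<in>cball 0 (snd (X n)). fst (X (Suc n)) x = fst (X n) x) \<and>
        snd (X n) \<le> snd (X (Suc n)) \<and> (\<exists>y. good n (fst (X (Suc n))) (snd (X (Suc n))) y))"
  proof (rule dependent_nat_choice)
    show "\<exists>X :: (real^3 \<Rightarrow> real) \<times> real. C_infinity (fst X) \<and> real 0 \<le> snd X"
      by (intro exI[of _ "(\<lambda>x. 0, 0)"]) (simp add: C_infinity_const)
  next
    fix X :: "(real^3 \<Rightarrow> real) \<times> real" and n
    assume X: "C_infinity (fst X) \<and> real n \<le> snd X"
    have "0 < \<epsilon> n" by (simp add: \<epsilon>_def)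
    obtain G R y where G: "C_infinity G" "\<And>x. x \<in> cball 0 (snd X) \<Longrightarrow> G x = fst X x"
      "snd X + 1 \<le> R" "\<And>t. t \<in> {a..b} \<Longrightarrow> \<bar>y t - p (i n) t\<bar> \<le> \<epsilon> n"
      "\<And>F. (\<And>x. x \<in> cball 0 R \<Longrightarrow> F x = G x) \<Longrightarrow> is_solution a b F y"
      by (rule prescribe_approximate_solution
          [OF conjunct1[OF X] spec[OF p, of "i n"] \<open>0 < \<epsilon> n\<close>, of "snd X" a b]) blast
    then have "good n G R y" by (auto simp: good_def)
    then show "\<exists>Y. (C_infinity (fst Y) \<and> real (Suc n) \<le> snd Y) \<and>
        ((\<forall>x\<in>cball 0 (snd X). fst Y x = fst X x) \<and> snd X \<le> snd Y \<and>
          (\<exists>y. good n (fst Y) (snd Y) y))"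
      using G X by (intro exI[of _ "(G, R)"]) auto
  qed
  then obtain X where X: "\<And>n. C_infinity (fst (X n))" "\<And>n. real n \<le> snd (X n)"
    "\<And>n x. x \<in> cball 0 (snd (X n)) \<Longrightarrow> fst (X (Suc n)) x = fst (X n) x"
    "\<And>n. snd (X n) \<le> snd (X (Suc n))"
    "\<And>n. \<exists>y. good n (fst (X (Suc n))) (snd (X (Suc n))) y"
    by blast
  obtain F where F: "C_infinity F" "\<And>n x. x \<in> cball 0 (snd (X n)) \<Longrightarrow> F x = fst (X n) x"
    using glue_exhaustion[of "\<lambda>n. fst (X n)" "\<lambda>n. snd (X n)"] X(1-4) by blast
  have approx: "\<exists>y\<in>solutions a b F. mdist (C0 a b) f y < r" if f: "f \<in> mspace (C0 a b)" and r: "0 < r"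
    for f r
  proof -
    have "continuous_on {a..b} f" using f by (simp add: mspace_C0)
    moreover have "0 < r / 4" using r by simp
    ultimately obtain j where j: "\<forall>t\<in>{a..b}. \<bar>f t - p j t\<bar> < r / 4"
      using dense by blast
    obtain m where m: "inverse (real (Suc m)) < r / 4"
      using reals_Archimedean[of "r / 4"] r by auto
    define n where "n = prod_encode (j, m)"
    obtain y where y: "good n (fst (X (Suc n))) (snd (X (Suc n))) y"
      using X(5) by blast
    have close: "\<bar>y t - p j t\<bar> \<le> inverse (real (Suc m))" if "t \<in> {a..b}" for t
      using y that unfolding good_def by (simp add: n_def i_def \<epsilon>_def)
    have "is_solution a b F y"
      using y F(2)[of _ "Suc n"] unfolding good_def by blast
    let ?y = "restrict y {a..b}"
    have sol: "?y \<in> solutions a b F"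
      using is_solution_restrict[OF \<open>is_solution a b F y\<close>] by (simp add: solutions_def)
    have mem: "?y \<in> mspace (C0 a b)"
      using sol solutions_subset_C0 by blast
    have "\<bar>f t - ?y t\<bar> \<le> r / 2" if "t \<in> {a..b}" for t
      using bspec[OF j that] close[OF that] m that by (simp add: abs_if split: if_splits)
    then have "mdist (C0 a b) f ?y \<le> r / 2"
      using C0_mdist_le[OF f mem less_imp_le[OF assms]] by blast
    then show ?thesis using sol r by (intro bexI[of _ ?y]) auto
  qed
  have "mtopology_of (C0 a b) closure_of solutions a b F = mspace (C0 a b)"
    unfolding mtopology_of_def Metric_space.metric_closure_of[OF Metric_space_mspace_mdist]
      Metric_space.in_mball[OF Metric_space_mspace_mdist]
    using approx solutions_subset_C0 by fastforce
  with F(1) show ?thesis by blast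
qed

end
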